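(* If $G$ is a finite connected graph, then $\mathrm{rc}(G) \geq \left\lfloor \frac{g(G)}{2}\right\rfloor-1$.
   Context: Cop and robber game with radius of capture $k$ on a graph $G$: first the cop chooses a vertex, then the robber chooses a vertex; afterwards, starting with the cop, the players alternately either move to an adjacent vertex or stay put, both knowing both positions. The cop wins if at some point the distance between the players is at most $k$. $\mathcal{CWRC}(k)$ is the class of graphs on which the cop has a winning strategy. $\mathrm{rc}(G)=\min\{k\in\mathbb{N}_0 \mid G\in\mathcal{CWRC}(k)\}$. The girth $g(G)$ is the length of a shortest cycle of $G$; acyclic graphs are considered to have girth $0$. *)

theory Defs
  imports "Graph_Theory.Graph_Theory"
begin

text \<open>
  Undirected simple graphs are loopless symmetric digraphs without parallel arcs, as in
  the locale \<^locale>\<open>graph\<close>, which moreover requires finiteness.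
\<close>

definition simple_graph :: "('a, 'b) pre_digraph \<Rightarrow> bool" where
  "simple_graph G \<longleftrightarrow> loopfree_digraph G \<and> nomulti_digraph G \<and> sym_digraph G"

text \<open>Every arc has weight 1; the distance is infinite if no walk joins the vertices.\<close>

definition graph_dist :: "('a, 'b) pre_digraph \<Rightarrow> 'a \<Rightarrow> 'a \<Rightarrow> ereal" where
  "graph_dist G u v = wf_digraph.\<mu> G (\<lambda>_. 1) u v"

text \<open>
  The bound 3 excludes the closed walks a, b, a, which are cycles of a symmetric digraph
  but not of the undirected graph it represents.
\<close>

definition undirected_cycle :: "('a, 'b) pre_digraph \<Rightarrow> 'b awalk \<Rightarrow> bool" where
  "undirected_cycle G p \<longleftrightarrow> pre_digraph.cycle G p \<and> 3 \<le> length p"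

definition girth :: "('a, 'b) pre_digraph \<Rightarrow> nat" where
  "girth G =
    (if \<exists>p. undirected_cycle G p
     then LEAST n. \<exists>p. undirected_cycle G p \<and> length p = n
     else 0)"

text \<open>The sequences of positions that a single player may occupy in the course of a game.\<close>

definition legal_route :: "('a, 'b) pre_digraph \<Rightarrow> (nat \<Rightarrow> 'a) \<Rightarrow> bool" where
  "legal_route G p \<longleftrightarrow>
    p 0 \<in> verts G \<and> (\<forall>n. p (Suc n) = p n \<or> p n \<rightarrow>\<^bsub>G\<^esub> p (Suc n))"

text \<open>
  A cop strategy maps the list of all previous robber positions to the next cop position;
  the value at the empty list is the initial cop position. The cop's own previous positions
  are determined by the strategy and that list. Against the robber positions
  \<open>r 0, r 1, \<dots>\<close>, the order of play is \<open>c 0, r 0, c 1, r 1, \<dots>\<close>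
  where \<open>c = cop_route s r\<close>.
\<close>

definition cop_route :: "('a list \<Rightarrow> 'a) \<Rightarrow> (nat \<Rightarrow> 'a) \<Rightarrow> nat \<Rightarrow> 'a" where
  "cop_route s r n = s (map r [0..<n])"

text \<open>
  The pairs of positions that occur are \<open>(c n, r n)\<close>, after a robber move, and
  \<open>(c (Suc n), r n)\<close>, after a cop move.
\<close>

definition cop_winning_strategy ::
    "('a, 'b) pre_digraph \<Rightarrow> nat \<Rightarrow> ('a list \<Rightarrow> 'a) \<Rightarrow> bool" where
  "cop_winning_strategy G k s \<longleftrightarrow>
    (\<forall>r. legal_route G r \<longrightarrow>
      legal_route G (cop_route s r) \<and>
      (\<exists>n. graph_dist G (cop_route s r n) (r n) \<le> ereal (real k) \<or>
           graph_dist G (cop_route s r (Suc n)) (r n) \<le> ereal (real k)))"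

definition CWRC :: "nat \<Rightarrow> ('a, 'b) pre_digraph set" where
  "CWRC k = {G. simple_graph G \<and> (\<exists>s. cop_winning_strategy G k s)}"

text \<open>
  For finite connected graphs the minimum exists, since the cop wins at once if \<open>k\<close> is
  at least the diameter.
\<close>

definition rc :: "('a, 'b) pre_digraph \<Rightarrow> nat" where
  "rc G = (LEAST k. G \<in> CWRC k)"

end

theory Submission
  imports Defs
begin

text \<open>
  If two neighbours of \<open>r\<close> are at most as far from \<open>c\<close> as \<open>r\<close> itself, geodesics towards
  \<open>c\<close> close up to a cycle of length at most \<open>2 d(c,r) + 1\<close>. So if the girth is at least
  \<open>2k + 4\<close>, a robber on a fixed cycle whose distance to the cop is at most \<open>k + 1\<close> has a
  neighbour on that cycle farther from the cop. He can hence start at distance at least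
  \<open>k + 2\<close> and restore this distance after each cop move, which decreases it by at most 1.
\<close>

section \<open>Distances as natural numbers\<close>

text \<open>A natural-valued distance allows induction on the level of a vertex; it is meaningful
  only if \<open>v\<close> is reachable from \<open>u\<close>.\<close>

definition (in wf_digraph) hops :: "'a \<Rightarrow> 'a \<Rightarrow> nat" where
  "hops u v = (LEAST n. \<exists>p. awalk u p v \<and> length p = n)"

context wf_digraph begin

lemma hops_le: "awalk u p v \<Longrightarrow> hops u v \<le> length p"
  unfolding hops_def by (rule Least_le) blast

lemma awalk_hops:
  assumes "u \<rightarrow>\<^sup>* v"
  obtains p where "awalk u p v" "length p = hops u v"
proof -
  from assms obtain p where "awalk u p v"
    by (auto simp: reachable_awalk)
  then have "\<exists>n p. awalk u p v \<and> length p = n"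
    by blast
  from LeastI_ex[OF this] show thesis
    using that unfolding hops_def by blast
qed

lemma awalk_cost_unit: "awalk_cost (\<lambda>_. 1) p = real (length p)"
  by (induct p) auto

text \<open>A shortest walk attains the infimum that defines \<open>\<mu>\<close>.\<close>

lemma graph_dist_eq_hops:
  assumes "u \<rightarrow>\<^sup>* v"
  shows "graph_dist G u v = ereal (real (hops u v))"
proof -
  obtain p where p: "awalk u p v" "length p = hops u v"
    using assms by (rule awalk_hops)
  show ?thesis
    unfolding graph_dist_def \<mu>_def awalk_cost_unit
  proof (rule antisym)
    show "(INF q\<in>{q. awalk u q v}. ereal (real (length q))) \<le> ereal (real (hops u v))"
      using p by (intro INF_lower2[of p]) auto
    show "ereal (real (hops u v)) \<le> (INF q\<in>{q. awalk u q v}. ereal (real (length q)))"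
      by (intro INF_greatest) (auto dest: hops_le)
  qed
qed

lemma hops_arc_source:
  assumes "u \<rightarrow> v" "v \<rightarrow>\<^sup>* w"
  shows "hops u w \<le> Suc (hops v w)"
proof -
  obtain p where "awalk v p w" "length p = hops v w"
    using assms(2) by (rule awalk_hops)
  moreover obtain e where "e \<in> arcs G" "tail G e = u" "head G e = v"
    using assms(1) by auto
  ultimately show ?thesis
    using hops_le[of u "e # p" w] by (auto simp: awalk_simps)
qed

text \<open>Take the last but one vertex of a shortest walk: dropping the last arc and appending it
  to a shortest walk give the two inequalities.\<close>

lemma hops_predecessor:
  assumes "u \<rightarrow>\<^sup>* w" "u \<noteq> w"
  obtains v where "u \<rightarrow>\<^sup>* v" "v \<rightarrow> w" "hops u w = Suc (hops u v)"
proof -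
  obtain p where p: "awalk u p w" "length p = hops u w"
    using assms(1) by (rule awalk_hops)
  with assms(2) have "p \<noteq> []"
    by (auto simp: awalk_Nil_iff)
  then obtain q e where q: "p = q @ [e]"
    by (cases p rule: rev_cases) auto
  with p have e: "awalk u q (tail G e)" "e \<in> arcs G" "head G e = w"
    by (auto simp: awalk_simps)
  obtain q' where q': "awalk u q' (tail G e)" "length q' = hops u (tail G e)"
    using awalk_hops reachable_awalkI[OF e(1)] by blast
  have "awalk u (q' @ [e]) w"
    using awalk_appendI[OF q'(1) arc_implies_awalk[OF e(2)]] e(3) by simp
  then have "hops u w \<le> Suc (hops u (tail G e))"
    using hops_le[of u "q' @ [e]" w] q'(2) by simp
  moreover have "Suc (hops u (tail G e)) \<le> hops u w"
    using hops_le[OF e(1)] p(2) q by simp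
  moreover have "tail G e \<rightarrow> w"
    using e in_arcs_imp_in_arcs_ends[OF e(2)] by simp
  ultimately show thesis
    using that[OF reachable_awalkI[OF e(1)]] by simp
qed

end

section \<open>Short cycles from geodesics, and neighbours on a cycle\<close>

lemma (in sym_digraph) adj_sym: "u \<rightarrow> v \<Longrightarrow> v \<rightarrow> u"
  by (rule arcs_ends_symmetric[OF sym_arcs])

text \<open>Descend from both vertices along geodesics towards \<open>c\<close> until the two geodesics meet.\<close>

lemma (in sym_digraph) apath_below_level:
  assumes "c \<rightarrow>\<^sup>* u" "c \<rightarrow>\<^sup>* v" "hops c u = n" "hops c v = n" "u \<noteq> v"
  shows "\<exists>p. apath u p v \<and> 2 \<le> length p \<and> length p \<le> 2 * n \<and>
    (\<forall>x \<in> set (awalk_verts u p). hops c x \<le> n)"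
  using assms
proof (induct n arbitrary: u v)
  case 0
  then show ?case
    by (metis awalk_hops awalk_empty_ends length_0_conv)
next
  case (Suc n)
  have "hops c c = 0"
    using hops_le[of c "[]" c] Suc.prems(1) by (auto simp: awalk_Nil_iff reachable_in_verts)
  with Suc.prems have "c \<noteq> u" "c \<noteq> v"
    by auto
  have descend: "\<exists>y. c \<rightarrow>\<^sup>* y \<and> y \<rightarrow> x \<and> hops c y = n"
    if x: "c \<rightarrow>\<^sup>* x" "c \<noteq> x" "hops c x = Suc n" for x
    using hops_predecessor[OF x(1,2)] x(3) by (metis nat.inject)
  obtain u' where u': "c \<rightarrow>\<^sup>* u'" "u' \<rightarrow> u" "hops c u' = n"
    using descend[of u] Suc.prems \<open>c \<noteq> u\<close> by blast
  obtain v' where v': "c \<rightarrow>\<^sup>* v'" "v' \<rightarrow> v" "hops c v' = n"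
    using descend[of v] Suc.prems \<open>c \<noteq> v\<close> by blast
  have "u \<rightarrow> u'"
    using u'(2) by (rule adj_sym)
  then obtain e where e: "e \<in> arcs G" "tail G e = u" "head G e = u'"
    by auto
  obtain f where f: "f \<in> arcs G" "tail G f = v'" "head G f = v"
    using v'(2) by auto
  have ne: "u \<noteq> u'" "v \<noteq> v'"
    using Suc.prems(3,4) u'(3) v'(3) by auto
  have verts: "u \<in> verts G" "v \<in> verts G"
    using u'(2) v'(2) adj_in_verts by blast+
  show ?case
  \<comment> \<open>Either the geodesics meet in a common predecessor, or the path between the two
    predecessors is extended at both ends.\<close>
  proof (cases "u' = v'")
    case True
    have "apath u [e, f] v"
      using e f verts ne True Suc.prems(5) by (simp add: apath_simps)
    moreover have "\<forall>x \<in> set (awalk_verts u [e, f]). hops c x \<le> Suc n"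
      using e f True Suc.prems(3,4) u'(3) by simp
    ultimately show ?thesis
      by (intro exI[of _ "[e, f]"]) simp
  next
    case False
    then obtain p where p: "apath u' p v'" "2 \<le> length p" "length p \<le> 2 * n"
      "\<forall>x \<in> set (awalk_verts u' p). hops c x \<le> n"
      using Suc.hyps u' v' by blast
    have ends: "awlast u' p = v'"
      using p(1) by (auto simp: apath_def)
    \<comment> \<open>The level bound in the induction keeps the extended walk a path:
      \<open>p\<close> stays within level \<open>n\<close>, while \<open>u\<close> and
      \<open>v\<close> have level \<open>Suc n\<close>.\<close>
    have notin: "u \<notin> set (awalk_verts u' p)" "v \<notin> set (awalk_verts u' p)"
      using p(4) Suc.prems(3,4) by force+
    have pf: "apath u' (p @ [f]) v"
      using p(1) f ends notin verts ne
      by (simp add: apath_append_iff apath_simps)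
    have pf_verts: "set (awalk_verts u' (p @ [f])) = insert v (set (awalk_verts u' p))"
      using awalk_verts_append[OF awalkI_apath[OF pf]] f by simp
    have "apath u (e # p @ [f]) v"
      using e pf notin(1) pf_verts Suc.prems(5) by (simp add: apath_Cons_iff)
    moreover have "\<forall>x \<in> set (awalk_verts u (e # p @ [f])). hops c x \<le> Suc n"
      using e pf_verts p(4) Suc.prems(3,4) by (simp add: le_Suc_eq)
    ultimately show ?thesis
      using p(2,3) by (intro exI[of _ "e # p @ [f]"]) simp
  qed
qed

lemma (in wf_digraph) undirected_cycle_close_apath:
  assumes "apath u p v" "v \<rightarrow> u" "2 \<le> length p"
  obtains q where "undirected_cycle G q" "length q = Suc (length p)"
proof -
  obtain e where e: "e \<in> arcs G" "tail G e = v" "head G e = u"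
    using assms(2) by auto
  \<comment> \<open>With the closing arc in front, dropping the first vertex of the closed walk
    leaves exactly the distinct vertices of \<open>p\<close>.\<close>
  have "cycle (e # p)"
    unfolding cycle_def using assms(1) e
    by (intro exI[of _ v]) (auto simp: awalk_simps apath_def)
  then show thesis
    using that[of "e # p"] assms(3) by (simp add: undirected_cycle_def)
qed

text \<open>If a neighbour lies on the level of \<open>r\<close>, a path between the two within that
  level is closed by one arc. Otherwise both neighbours lie one level lower, and a path between them
  is closed through \<open>r\<close>, with length at most \<open>2 * hops c r\<close>.\<close>

lemma (in graph) short_cycle_of_two_neighbours:
  assumes r: "c \<rightarrow>\<^sup>* r" and ab: "a \<rightarrow> r" "b \<rightarrow> r" "a \<noteq> b"
    and le: "hops c a \<le> hops c r" "hops c b \<le> hops c r"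
  obtains p where "undirected_cycle G p" "length p \<le> 2 * hops c r + 1"
proof -
  note short = that
  have reach: "c \<rightarrow>\<^sup>* a" "c \<rightarrow>\<^sup>* b"
    using r ab adj_sym by (meson reachable_adj_trans)+
  have ne: "a \<noteq> r" "b \<noteq> r"
    using ab adj_not_same by auto
  have level: thesis if x: "x \<rightarrow> r" "c \<rightarrow>\<^sup>* x" "x \<noteq> r" "hops c x = hops c r" for x
  proof -
    obtain p where p: "apath r p x" "2 \<le> length p" "length p \<le> 2 * hops c r"
      using apath_below_level[of c r x "hops c r"] r x by auto
    obtain q where "undirected_cycle G q" "length q = Suc (length p)"
      using undirected_cycle_close_apath[OF p(1) x(1) p(2)] .
    with p(3) show thesis
      using short[of q] by simp
  qed
  have Suc: "hops c r \<le> Suc (hops c x)" if x: "x \<rightarrow> r" "c \<rightarrow>\<^sup>* x" for x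
  proof -
    obtain p where p: "awalk c p x" "length p = hops c x"
      using x(2) by (rule awalk_hops)
    obtain e where e: "e \<in> arcs G" "tail G e = x" "head G e = r"
      using x(1) by auto
    then have "awalk x [e] r"
      using arc_implies_awalk by blast
    with p(1) have "awalk c (p @ [e]) r"
      by (rule awalk_appendI)
    then show ?thesis
      using hops_le[of c "p @ [e]" r] p(2) by simp
  qed
  show thesis
  proof (cases "hops c a = hops c r \<or> hops c b = hops c r")
    case True
    then show thesis
      using level[OF ab(1) reach(1) ne(1)] level[OF ab(2) reach(2) ne(2)] by argo
  next
    case False
    then have eq: "hops c r = Suc (hops c a)" "hops c b = hops c a"
      using le Suc[OF ab(1) reach(1)] Suc[OF ab(2) reach(2)] by linarith+
    then obtain p where p: "apath a p b" "2 \<le> length p" "length p \<le> 2 * hops c a"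
        "\<forall>x \<in> set (awalk_verts a p). hops c x \<le> hops c a"
      using apath_below_level[of c a b "hops c a"] reach ab by auto
    obtain e where e: "e \<in> arcs G" "tail G e = r" "head G e = a"
      using adj_sym[OF ab(1)] by auto
    \<comment> \<open>The path stays on levels up to that of \<open>a\<close>, one below
      \<open>r\<close>.\<close>
    have "r \<notin> set (awalk_verts a p)"
      using p(4) eq(1) by force
    then have "apath r (e # p) b"
      using p(1) e by (simp add: apath_Cons_iff)
    from undirected_cycle_close_apath[OF this ab(2)] p(2)
    obtain q where "undirected_cycle G q" "length q = Suc (length (e # p))"
      by auto
    then show thesis
      using short[of q] p(3) eq(1) by simp
  qed
qed

text \<open>The neighbours are the successor and the predecessor of \<open>v\<close> on the cycle,
  which differ because its length is at least 3.\<close>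

lemma (in sym_digraph) undirected_cycle_two_neighbours:
  assumes "undirected_cycle G p" "v \<in> tail G ` set p"
  obtains a b where "a \<in> tail G ` set p" "b \<in> tail G ` set p" "a \<noteq> b" "a \<rightarrow> v" "b \<rightarrow> v"
proof -
  obtain u where u: "awalk u p u" "distinct (tl (awalk_verts u p))" "3 \<le> length p"
    using assms(1) by (auto simp: undirected_cycle_def cycle_def)
  \<comment> \<open>Apart from the first, the vertices of the walk are the heads of its arcs. In
    this form distinctness survives rotating the cycle to start at \<open>v\<close>.\<close>
  have "distinct (map (head G) p)"
    using u awalk_verts_conv'[of u p u] by (auto split: if_splits)
  moreover obtain xs e ys where p: "p = xs @ e # ys" "tail G e = v"
    using assms(2) by (auto simp: in_set_conv_decomp)
  ultimately have dist: "distinct (map (head G) (e # ys @ xs))"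
    by auto
  have "awalk u xs v" "awalk v (e # ys) u"
    using u(1) p by (auto simp: awalk_simps)
  then have "awalk v ((e # ys) @ xs) v"
    by (rule awalk_appendI[rotated])
  then have w: "awalk v (e # ys @ xs) v" by simp
  have "2 \<le> length (ys @ xs)"
    using u(3) p by simp
  then obtain f zs g where fg: "ys @ xs = (f # zs) @ [g]"
    by (cases "ys @ xs" rule: rev_cases; cases "butlast (ys @ xs)") auto
  have arcs: "e \<in> arcs G" "g \<in> arcs G" "tail G f = head G e" "head G g = v"
    using w unfolding fg by (auto simp: awalk_simps)
  have "awalk (head G e) (f # zs) (tail G g)"
    using w unfolding fg by (auto simp: awalk_simps)
  \<comment> \<open>At least the arc \<open>f\<close> lies between \<open>e\<close> and
    \<open>g\<close>, so \<open>tail G g\<close> is the head of an arc other than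
    \<open>e\<close>.\<close>
  then have "tail G g = head G (last (f # zs))"
    using awalk_verts_conv[of "head G e" "f # zs"] by (metis awlast_if_cas awalk_def last_snoc list.discI)
  moreover have "head G e \<notin> head G ` set (f # zs)"
    using dist unfolding fg by auto
  ultimately have "head G e \<noteq> tail G g"
    using last_in_set[of "f # zs"] by auto
  moreover have "set p = set (e # (f # zs) @ [g])"
    unfolding fg[symmetric] using p by auto
  then have "head G e \<in> tail G ` set p" "tail G g \<in> tail G ` set p"
    using arcs(3) by (auto simp: image_iff)
  moreover have "head G e \<rightarrow> v"
    using adj_sym in_arcs_imp_in_arcs_ends[OF arcs(1)] p(2) by auto
  moreover have "tail G g \<rightarrow> v"
    using in_arcs_imp_in_arcs_ends[OF arcs(2)] arcs(4) by auto
  ultimately show thesis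
    using that by blast
qed

section \<open>The robber's evasion\<close>

text \<open>The cop's strategy reads the whole history, so the robber's reply does too. Primitive
  recursion on the history itself provides such a route.\<close>

lemma exists_history_recursion:
  fixes f :: "'a list \<Rightarrow> 'a"
  obtains r where "\<And>n. r n = f (map r [0..<n])"
proof
  define h where "h = rec_nat [] (\<lambda>_ l. l @ [f l])"
  have h: "h 0 = []" "\<And>n. h (Suc n) = h n @ [f (h n)]"
    by (auto simp: h_def)
  have "map (\<lambda>i. f (h i)) [0..<n] = h n" for n
    by (induct n) (auto simp: h)
  then show "f (h n) = f (map (\<lambda>i. f (h i)) [0..<n])" for n
    by simp
qed

lemma (in wf_digraph) legal_route_in_verts: "legal_route G r \<Longrightarrow> r n \<in> verts G"
  unfolding legal_route_def by (induct n) (auto, metis adj_in_verts(2))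

lemma (in sym_digraph) connected_reachable:
  assumes "connected G" "u \<in> verts G" "v \<in> verts G"
  shows "u \<rightarrow>\<^sup>* v"
  using assms reachable_mk_symmetric_eq[OF sym_arcs]
  by (auto simp: connected_def strongly_connected_def)

lemma (in graph) robber_escapes:
  assumes conn: "connected G" and C: "undirected_cycle G C"
    and long: "\<And>p. undirected_cycle G p \<Longrightarrow> 2 * k + 4 \<le> length p"
  shows "\<not> cop_winning_strategy G k s"
proof
  assume win: "cop_winning_strategy G k s"
  define V where "V = tail G ` set C"
  have V: "V \<subseteq> verts G" "V \<noteq> {}" "finite V"
    using C by (auto simp: V_def undirected_cycle_def cycle_def awalk_def subset_iff)
  have farther: "\<exists>x \<in> V. r \<rightarrow> x \<and> hops c r < hops c x"
    if c: "c \<in> verts G" and r: "r \<in> V" "hops c r \<le> k + 1" for c r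
  proof -
    obtain a b where ab: "a \<in> V" "b \<in> V" "a \<noteq> b" "a \<rightarrow> r" "b \<rightarrow> r"
      using undirected_cycle_two_neighbours[OF C] r(1) unfolding V_def by metis
    have "c \<rightarrow>\<^sup>* r"
      using connected_reachable conn c r(1) V(1) by auto
    have "hops c r < hops c a \<or> hops c r < hops c b"
    proof (rule ccontr)
      assume "\<not> ?thesis"
      then obtain p where "undirected_cycle G p" "length p \<le> 2 * hops c r + 1"
        using short_cycle_of_two_neighbours[OF \<open>c \<rightarrow>\<^sup>* r\<close> ab(4,5,3)] by auto
      \<comment> \<open>The cycle would have length at most \<open>2 * (k + 1) + 1\<close>, which is
        less than \<open>2 * k + 4\<close>.\<close>
      with long[of p] r(2) show False
        by simp
    qed
    then show ?thesis
      using ab adj_sym by blast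
  qed
  have start: "\<exists>x \<in> V. k + 2 \<le> hops c x" if c: "c \<in> verts G" for c
  proof -
    have fin: "finite (hops c ` V)" "hops c ` V \<noteq> {}"
      using V by auto
    \<comment> \<open>A vertex of the cycle at maximal distance from \<open>c\<close> has no farther
      neighbour on it, so by \<open>farther\<close> its distance exceeds
      \<open>k + 1\<close>.\<close>
    from Max_in[OF this] obtain r where r: "r \<in> V" "hops c r = Max (hops c ` V)"
      by auto
    have "hops c x \<le> hops c r" if "x \<in> V" for x
      using Max_ge[OF fin(1)] that r(2) by simp
    then have "\<not> hops c r \<le> k + 1"
      using farther[OF c r(1)] by (meson leD)
    with r(1) show ?thesis
      by (intro bexI[of _ r]) simp_all
  qed
  have step: "\<exists>x \<in> V. (x = r \<or> r \<rightarrow> x) \<and> k + 2 \<le> hops c x"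
    if "c \<in> verts G" "r \<in> V" "k + 1 \<le> hops c r" for c r
  proof (cases "hops c r \<le> k + 1")
    case True
    with farther[OF that(1,2)] obtain x where "x \<in> V" "r \<rightarrow> x" "hops c r < hops c x"
      by blast
    with that(3) show ?thesis
      by (intro bexI[of _ x]) simp_all
  next
    case False
    with that(2) show ?thesis
      by (intro bexI[of _ r]) simp_all
  qed
  define good where "good l x \<longleftrightarrow> x \<in> V \<and> (l \<noteq> [] \<longrightarrow> x = last l \<or> last l \<rightarrow> x)" for l x
  \<comment> \<open>The cop's route is known to be legal only once the robber's is. The default
    values, some vertex of \<open>V\<close> or staying put, therefore make the robber's route legal
    against any \<open>s\<close>.\<close>
  define f where "f l =
    (if \<exists>x. good l x \<and> k + 2 \<le> hops (s l) x then SOME x. good l x \<and> k + 2 \<le> hops (s l) x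
     else if l = [] then SOME x. x \<in> V else last l)" for l
  obtain r where r: "\<And>n. r n = f (map r [0..<n])"
    using exists_history_recursion[of f] by blast
  define c where "c = cop_route s r"
  have f_far: "good l (f l) \<and> k + 2 \<le> hops (s l) (f l)"
    if "\<exists>x. good l x \<and> k + 2 \<le> hops (s l) x" for l
    using someI_ex[OF that] that by (simp add: f_def)
  have f_good: "good l (f l)" if "l \<noteq> [] \<Longrightarrow> last l \<in> V" for l
  proof (cases "\<exists>x. good l x \<and> k + 2 \<le> hops (s l) x")
    case True
    with f_far show ?thesis by blast
  next
    case False
    with that V(2) show ?thesis
      by (auto simp: f_def good_def some_in_eq)
  qed
  have good: "good (map r [0..<n]) (r n)" for n
  proof (induct n)
    case 0
    show ?case
      using f_good[of "[]"] r[of 0] by simp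
  next
    case (Suc n)
    then have "last (map r [0..<Suc n]) \<in> V"
      by (simp add: good_def)
    then show ?case
      using f_good[of "map r [0..<Suc n]"] r[of "Suc n"] by presburger
  qed
  have rV: "r n \<in> V" for n
    using good[of n] by (simp add: good_def)
  have "legal_route G r"
    unfolding legal_route_def using rV V(1) good[of "Suc n" for n] by (auto simp: good_def)
  then have c: "legal_route G c"
    and capture: "\<exists>n. graph_dist G (c n) (r n) \<le> ereal (real k) \<or>
       graph_dist G (c (Suc n)) (r n) \<le> ereal (real k)"
    using win by (auto simp: cop_winning_strategy_def c_def)
  have cv: "c n \<in> verts G" for n
    using c by (rule legal_route_in_verts)
  have reach: "c m \<rightarrow>\<^sup>* r n" for m n
    using connected_reachable[OF conn cv] rV V(1) by blast
  \<comment> \<open>One cop move costs at most 1, so even right after it the distance still exceeds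
    \<open>k\<close>.\<close>
  have far': "k + 1 \<le> hops (c (Suc n)) (r n)" if "k + 2 \<le> hops (c n) (r n)" for n
  proof -
    have "c (Suc n) = c n \<or> c n \<rightarrow> c (Suc n)"
      using c by (auto simp: legal_route_def)
    then show ?thesis
      using hops_arc_source[of "c n" "c (Suc n)" "r n"] that reach by auto
  qed
  have far: "k + 2 \<le> hops (c n) (r n)" for n
  proof (induct n)
    case 0
    have "\<exists>x. good [] x \<and> k + 2 \<le> hops (s []) x"
      using start[OF cv[of 0]] by (auto simp: good_def c_def cop_route_def)
    from f_far[OF this] show ?case
      using r[of 0] by (simp add: c_def cop_route_def)
  next
    case (Suc n)
    let ?l = "map r [0..<Suc n]"
    have "last ?l = r n" "s ?l = c (Suc n)"
      by (simp_all add: c_def cop_route_def)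
    then have "\<exists>x. good ?l x \<and> k + 2 \<le> hops (s ?l) x"
      using step[OF cv[of "Suc n"] rV far'[OF Suc]] unfolding good_def by metis
    from f_far[OF this] show ?case
      using r[of "Suc n"] \<open>s ?l = c (Suc n)\<close> by argo
  qed
  obtain n where "hops (c n) (r n) \<le> k \<or> hops (c (Suc n)) (r n) \<le> k"
    using capture unfolding graph_dist_eq_hops[OF reach] ereal_less_eq of_nat_le_iff by blast
  moreover have "k + 2 \<le> hops (c n) (r n)" "k + 1 \<le> hops (c (Suc n)) (r n)"
    using far far' by blast+
  ultimately show False
    by linarith
qed

section \<open>Existence of the minimum and the bound\<close>

text \<open>This makes the \<open>LEAST\<close> in \<open>rc\<close> an attained value. A cop who
  stays at \<open>v\<close> wins at once if \<open>k\<close> is the largest distance from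
  \<open>v\<close>.\<close>

lemma (in graph) CWRC_nonempty:
  assumes "connected G" "v \<in> verts G"
  shows "\<exists>k. G \<in> CWRC k"
proof -
  define k where "k = Max (hops v ` verts G)"
  have "cop_winning_strategy G k (\<lambda>_. v)"
    unfolding cop_winning_strategy_def
  proof (intro allI impI conjI exI[of _ 0] disjI1)
    fix r assume r: "legal_route G r"
    show "legal_route G (cop_route (\<lambda>_. v) r)"
      using assms by (simp add: legal_route_def cop_route_def)
    have "r 0 \<in> verts G"
      using r by (rule legal_route_in_verts)
    then show "graph_dist G (cop_route (\<lambda>_. v) r 0) (r 0) \<le> ereal (real k)"
      using connected_reachable[OF assms]
      by (auto simp: graph_dist_eq_hops cop_route_def k_def)
  qed
  moreover have "simple_graph G"
    unfolding simple_graph_def by (intro conjI; unfold_locales)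
  ultimately show ?thesis
    by (auto simp: CWRC_def)
qed

theorem theorem3p4:
  fixes G :: "('a, 'b) pre_digraph"
  assumes "graph G" and "connected G"
  shows "int (rc G) \<ge> \<lfloor>real (girth G) / 2\<rfloor> - 1"
proof (rule ccontr)
  interpret graph G by fact
  assume "\<not> ?thesis"
  \<comment> \<open>The negated claim says that \<open>rc G + 2\<close> is at most the floor of half
    the girth.\<close>
  then have small: "2 * rc G + 4 \<le> girth G"
    by linarith
  \<comment> \<open>The girth is positive, which rules out the default value 0 of acyclic
    graphs.\<close>
  then have ex: "\<exists>p. undirected_cycle G p"
    by (auto simp: girth_def split: if_splits)
  then have girth_le: "girth G \<le> length p" if "undirected_cycle G p" for p
    using that by (auto simp: girth_def intro: Least_le)
  have "verts G \<noteq> {}"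
    using ex by (auto simp: undirected_cycle_def cycle_def)
  then have "\<exists>k. G \<in> CWRC k"
    using CWRC_nonempty assms(2) by blast
  then have "G \<in> CWRC (rc G)"
    unfolding rc_def by (rule LeastI_ex)
  moreover obtain C where "undirected_cycle G C"
    using ex by blast
  ultimately show False
    using robber_escapes[OF assms(2)] small girth_le by (force simp: CWRC_def)
qed

end
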